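(* Let $K\ge 2$ be an integer. With the setting and notation of the context, the optimal $K$-$1$-ROM-dictionary partitions of $\mathcal{M}$, i.e. the partitions of $\mathcal{M}$ into $K$ subsets that minimize $$\{\mathcal{P}_k\}_{1\le k\le K}\ \longmapsto\ \sum_{k=1}^{K}\mathbb{P}(\mathcal{P}_k)\,\check{d}_1^{\,2}(p_{U|u\in\mathcal{P}_k})_{\mathcal{H}},$$ are exactly the solutions of the representative-based clustering problem on the quotient set $(\mathcal{H}\setminus\{0\})/\sim_{\tilde{\delta}_1}$ endowed with $\tilde{\delta}_1$, i.e. the partitions of $\mathcal{M}$ into $K$ subsets that minimize $$\{\mathcal{P}_k\}_{1\le k\le K}\ \longmapsto\ \sum_{k=1}^{K}\mathbb{P}(\mathcal{P}_k)\ \inf_{\tilde{u}_k\in(\mathcal{H}\setminus\{0\})/\sim_{\tilde{\delta}_1}}\ \mathbb{E}_{U\sim p_{U|u\in\mathcal{P}_k}}\left[\tilde{\delta}_1(U,\tilde{u}_k)_{\mathcal{H}}^2\right].$$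
   Context: Let $\Omega\subset\mathbb{R}^d$ be open, and let $\mathcal{H}\subset L^2(\Omega)$ be a real Hilbert space with inner product $\langle\cdot,\cdot\rangle_{\mathcal{H}}$ and induced norm $\|\cdot\|_{\mathcal{H}}$. Let $\mathcal{X}\subset\mathbb{R}^p$ be a parameter domain and $u:\mathcal{X}\to\mathcal{H}$ a continuous map (the solution map of a well-posed parametrized PDE). The solution manifold is $\mathcal{M}=u(\mathcal{X})$; it is assumed that there is $\lambda>0$ with $\inf_{v\in\mathcal{M}}\|v\|_{\mathcal{H}}>\lambda$. Let $X$ be a random variable with values in $\mathcal{X}$ and let $p_U$ be the probability distribution of $U:=u(X)$; its support is $\mathcal{M}$. For $\mathcal{P}\subset\mathcal{M}$, $\mathbb{P}(\mathcal{P})$ is the probability of the event $U\in\mathcal{P}$, and $p_{U|u\in\mathcal{P}}$ is the conditional distribution of $U$ given $U\in\mathcal{P}$. A partition $\{\mathcal{P}_k\}_{1\le k\le K}$ of $\mathcal{M}$ is a collection of non-empty subsets of $\mathcal{M}$ such that every point of $\mathcal{M}$ belongs to exactly one of them. The subsets are taken to be measurable, and a term with $\mathbb{P}(\mathcal{P}_k)=0$ is counted as $0$. For an integer $N\ge1$, $\mathrm{Gr}(N,\mathcal{H})$ is the set of $N$-dimensional linear subspaces of $\mathcal{H}$. For $v\in\mathcal{H}\setminus\{0\}$ and $\mathcal{H}_N\in\mathrm{Gr}(N,\mathcal{H})$, the relative projection error is $\eta(v,\mathcal{H}_N)_{\mathcal{H}}:=\|v-\pi_{\mathcal{H}_N}(v)\|_{\mathcal{H}}/\|v\|_{\mathcal{H}}$,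 where $\pi_{\mathcal{H}_N}$ is the orthogonal projection onto $\mathcal{H}_N$. The normalized Kolmogorov $N$-width of a probability distribution $p$ on $\mathcal{H}\setminus\{0\}$ is $$\check{d}_N(p)_{\mathcal{H}}:=\left(\inf_{\mathcal{H}_N\in\mathrm{Gr}(N,\mathcal{H})}\mathbb{E}_{U\sim p}\left[\eta(U,\mathcal{H}_N)_{\mathcal{H}}^2\right]\right)^{1/2}.$$ An optimal $K$-$N$-ROM-dictionary partition of $\mathcal{M}$ is a partition of $\mathcal{M}$ into $K$ subsets minimizing $\sum_{k=1}^K\mathbb{P}(\mathcal{P}_k)\check{d}_N^{\,2}(p_{U|u\in\mathcal{P}_k})_{\mathcal{H}}$ among all such partitions. The sine dissimilarity is, for $v,w\in\mathcal{H}\setminus\{0\}$, $$\tilde{\delta}_1(v,w)_{\mathcal{H}}:=\sqrt{1-\frac{\langle v,w\rangle_{\mathcal{H}}^2}{\|v\|_{\mathcal{H}}^2\|w\|_{\mathcal{H}}^2}}.$$ The equivalence relation $\sim_{\tilde{\delta}_1}$ on $\mathcal{H}\setminus\{0\}$ is defined by $v\sim_{\tilde{\delta}_1}w\iff\tilde{\delta}_1(v,w)_{\mathcal{H}}=0$ (equivalently, $v$ and $w$ are collinear). Since $\tilde{\delta}_1$ is invariant under rescaling of either argument by a nonzero real number, it is well defined on the quotient set, and $\tilde{\delta}_1(v,\tilde{u})_{\mathcal{H}}$ for an equivalence class $\tilde{u}$ is its value on any representative. *)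

theory Defs
  imports "HOL-Probability.Probability"
begin

text \<open>
  A real Hilbert space is a type of sort \<open>{real_inner, complete_space}\<close>. That it is
  a linear subspace of \<open>L\<^sup>2(\<Omega>)\<close>, with an inner product of its own, is expressed by a map
  \<open>\<iota>\<close> choosing for every vector a square-integrable representative; \<open>\<iota>\<close> is linear and
  injective modulo equality almost everywhere.
\<close>

definition L2_realization ::
  "(real ^ 'd) set \<Rightarrow> ('h::real_inner \<Rightarrow> real ^ 'd \<Rightarrow> real) \<Rightarrow> bool" where
  "L2_realization \<Omega> \<iota> \<longleftrightarrow>
     (\<forall>v. \<iota> v \<in> borel_measurable (lebesgue_on \<Omega>) \<and>
          integrable (lebesgue_on \<Omega>) (\<lambda>x. (\<iota> v x)\<^sup>2)) \<and>
     (\<forall>a b v w. AE x in lebesgue_on \<Omega>.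
          \<iota> (a *\<^sub>R v + b *\<^sub>R w) x = a * \<iota> v x + b * \<iota> w x) \<and>
     (\<forall>v. (AE x in lebesgue_on \<Omega>. \<iota> v x = 0) \<longrightarrow> v = 0)"

text \<open>
  The distribution of \<open>u(X)\<close>, as a Borel measure on the solution manifold \<open>u ` D\<close>
  (which need not be a Borel subset of the whole space).
\<close>

definition solution_law ::
  "'w measure \<Rightarrow> ('w \<Rightarrow> 'x) \<Rightarrow> 'x set \<Rightarrow> ('x \<Rightarrow> 'h::topological_space) \<Rightarrow> 'h measure" where
  "solution_law P X D u = distr P (restrict_space borel (u ` D)) (\<lambda>\<omega>. u (X \<omega>))"

definition measure_support :: "'h::topological_space measure \<Rightarrow> 'h set" where
  "measure_support p =
     {v \<in> space p. \<forall>V. open V \<and> v \<in> V \<longrightarrow> emeasure p (V \<inter> space p) > 0}"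

definition measurable_partitions :: "'h measure \<Rightarrow> nat \<Rightarrow> 'h set set set" where
  "measurable_partitions p K =
     {\<P>. partition_on (space p) \<P> \<and> \<P> \<subseteq> sets p \<and> finite \<P> \<and> card \<P> = K}"

text \<open>Used for \<open>N \<ge> 1\<close> only: \<^const>\<open>dim\<close> is \<open>0\<close> on infinite-dimensional subspaces.\<close>

definition Gr :: "nat \<Rightarrow> 'h::real_inner set set" where
  "Gr N = {S. subspace S \<and> dim S = N}"

definition orth_proj :: "'h::real_inner set \<Rightarrow> 'h \<Rightarrow> 'h" where
  "orth_proj S v = (THE w. w \<in> S \<and> (\<forall>s\<in>S. orthogonal (v - w) s))"

definition rel_proj_error :: "'h::real_inner \<Rightarrow> 'h set \<Rightarrow> real" where
  "rel_proj_error v S = norm (v - orth_proj S v) / norm v"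

definition normalized_width :: "nat \<Rightarrow> 'h::real_inner measure \<Rightarrow> real" where
  "normalized_width N p = sqrt (INF S\<in>Gr N. \<integral>v. (rel_proj_error v S)\<^sup>2 \<partial>p)"

text \<open>
  \<^term>\<open>uniform_measure p Q\<close> is the conditional distribution of \<open>p\<close> given \<open>Q\<close>. If \<open>Q\<close> is a
  null set, the factor \<^term>\<open>measure p Q\<close> makes its term vanish in both objectives below.
\<close>

definition rom_objective :: "nat \<Rightarrow> 'h::real_inner measure \<Rightarrow> 'h set set \<Rightarrow> real" where
  "rom_objective N p \<P> =
     (\<Sum>Q\<in>\<P>. measure p Q * (normalized_width N (uniform_measure p Q))\<^sup>2)"

definition optimal_rom_dictionary_partition ::
  "nat \<Rightarrow> nat \<Rightarrow> 'h::real_inner measure \<Rightarrow> 'h set set \<Rightarrow> bool" where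
  "optimal_rom_dictionary_partition K N p =
     is_arg_min (rom_objective N p) (\<lambda>\<P>. \<P> \<in> measurable_partitions p K)"

definition sine_dissim :: "'h::real_inner \<Rightarrow> 'h \<Rightarrow> real" where
  "sine_dissim v w = sqrt (1 - (v \<bullet> w)\<^sup>2 / ((norm v)\<^sup>2 * (norm w)\<^sup>2))"

definition sine_rel :: "('h::real_inner \<times> 'h) set" where
  "sine_rel = {(v, w). v \<noteq> 0 \<and> w \<noteq> 0 \<and> sine_dissim v w = 0}"

text \<open>The common value of the sine dissimilarity on all representatives of a class.\<close>

definition sine_dissim_class :: "'h::real_inner \<Rightarrow> 'h set \<Rightarrow> real" where
  "sine_dissim_class v c = the_elem (sine_dissim v ` c)"

definition clustering_objective :: "'h::real_inner measure \<Rightarrow> 'h set set \<Rightarrow> real" where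
  "clustering_objective p \<P> =
     (\<Sum>Q\<in>\<P>. measure p Q *
        (INF c\<in>(UNIV - {0}) // sine_rel. \<integral>v. (sine_dissim_class v c)\<^sup>2 \<partial>uniform_measure p Q))"

definition optimal_clustering_partition ::
  "nat \<Rightarrow> 'h::real_inner measure \<Rightarrow> 'h set set \<Rightarrow> bool" where
  "optimal_clustering_partition K p =
     is_arg_min (clustering_objective p) (\<lambda>\<P>. \<P> \<in> measurable_partitions p K)"

end

theory Submission
  imports Defs
begin

text \<open>
  The relative error of projecting \<open>v\<close> onto the line spanned by \<open>w\<close> is the sine of the angle
  between \<open>v\<close> and \<open>w\<close>, and the lines are exactly the classes of collinear vectors with \<open>0\<close>
  added. Hence the two objectives agree on every partition of a set avoiding \<open>0\<close>.
\<close>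

text \<open>Pairing the residual with the generator \<open>w\<close> already fixes the coefficient,
  so the description in \<open>orth_proj\<close> has exactly one witness.\<close>

lemma orth_proj_span_singleton:
  fixes v w :: "'h::real_inner"
  assumes "w \<noteq> 0"
  shows "orth_proj (span {w}) v = ((v \<bullet> w) / (w \<bullet> w)) *\<^sub>R w"
  unfolding orth_proj_def
proof (rule the_equality)
  show "((v \<bullet> w) / (w \<bullet> w)) *\<^sub>R w \<in> span {w} \<and>
      (\<forall>s\<in>span {w}. orthogonal (v - ((v \<bullet> w) / (w \<bullet> w)) *\<^sub>R w) s)"
    using assms by (auto simp: span_singleton orthogonal_def inner_diff_left)
next
  fix x
  assume x: "x \<in> span {w} \<and> (\<forall>s\<in>span {w}. orthogonal (v - x) s)"
  then obtain k where k: "x = k *\<^sub>R w"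
    by (auto simp: span_singleton)
  have "orthogonal (v - x) w"
    using x span_base[of w "{w}"] by blast
  then have "v \<bullet> w = k * (w \<bullet> w)"
    by (simp add: k orthogonal_def inner_diff_left)
  then show "x = ((v \<bullet> w) / (w \<bullet> w)) *\<^sub>R w"
    using assms by (simp add: k)
qed

text \<open>Pythagoras: the squared residual is \<open>v \<bullet> v\<close> less the squared
  component along \<open>w\<close>. Dividing by \<open>v \<bullet> v\<close> gives the squared sine,
  and both sides are nonnegative.\<close>

lemma rel_proj_error_span_singleton:
  fixes v w :: "'h::real_inner"
  assumes "v \<noteq> 0" "w \<noteq> 0"
  shows "rel_proj_error v (span {w}) = sine_dissim v w"
proof -
  have "(norm (v - ((v \<bullet> w) / (w \<bullet> w)) *\<^sub>R w))\<^sup>2 = v \<bullet> v - (v \<bullet> w)\<^sup>2 / (w \<bullet> w)"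
    using assms unfolding power2_norm_eq_inner
    by (simp add: inner_diff_left inner_diff_right inner_commute[of w v] power2_eq_square)
  then have "(rel_proj_error v (span {w}))\<^sup>2 = 1 - (v \<bullet> w)\<^sup>2 / ((norm v)\<^sup>2 * (norm w)\<^sup>2)"
    using assms
    by (simp add: rel_proj_error_def orth_proj_span_singleton power_divide
        power2_norm_eq_inner diff_divide_distrib mult.commute)
  then show ?thesis
    unfolding sine_dissim_def
    by (metis real_sqrt_unique rel_proj_error_def divide_nonneg_nonneg norm_ge_zero)
qed

text \<open>The equality case of Cauchy-Schwarz, read off from projections: a zero error means that
  \<open>v\<close> is its own projection onto the line of \<open>w\<close>.\<close>

lemma sine_dissim_eq_0_imp_collinear:
  fixes v w :: "'h::real_inner"
  assumes "v \<noteq> 0" "w \<noteq> 0" "sine_dissim v w = 0"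
  obtains k where "k \<noteq> 0" "v = k *\<^sub>R w"
proof -
  have "v = orth_proj (span {w}) v"
    using assms rel_proj_error_span_singleton[of v w] by (simp add: rel_proj_error_def)
  then show ?thesis
    using that assms by (metis orth_proj_span_singleton scaleR_zero_left)
qed

lemma sine_dissim_scaleR_right:
  "k \<noteq> 0 \<Longrightarrow> sine_dissim v (k *\<^sub>R w) = sine_dissim v w"
  by (simp add: sine_dissim_def power_mult_distrib)

lemma sine_dissim_self: "w \<noteq> 0 \<Longrightarrow> sine_dissim w w = 0"
  by (simp add: sine_dissim_def power2_norm_eq_inner) (simp add: power2_eq_square)

text \<open>Well-definedness on the quotient: \<open>the_elem\<close> is meaningful here because
  members of a class differ by nonzero factors, which leave the sine unchanged.\<close>

lemma sine_dissim_class_eq: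
  fixes v w :: "'h::real_inner"
  assumes "w \<noteq> 0"
  shows "sine_dissim_class v (sine_rel `` {w}) = sine_dissim v w"
proof -
  have "sine_dissim v x = sine_dissim v w" if "x \<in> sine_rel `` {w}" for x
  proof -
    from that have "w \<noteq> 0" "x \<noteq> 0" "sine_dissim w x = 0"
      by (auto simp: sine_rel_def)
    then show ?thesis
      by (metis sine_dissim_eq_0_imp_collinear sine_dissim_scaleR_right)
  qed
  moreover have "w \<in> sine_rel `` {w}"
    using assms by (simp add: sine_rel_def sine_dissim_self)
  ultimately have "sine_dissim v ` (sine_rel `` {w}) = {sine_dissim v w}"
    by blast
  then show ?thesis
    by (simp add: sine_dissim_class_def)
qed

lemma Gr_1_eq: "Gr 1 = (\<lambda>w::'h::real_inner. span {w}) ` (UNIV - {0})"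
proof (intro equalityI subsetI)
  fix S :: "'h set"
  assume "S \<in> Gr 1"
  then have S: "subspace S" "dim S = 1"
    by (auto simp: Gr_def)
  obtain B where B: "B \<subseteq> S" "independent B" "S \<subseteq> span B" "card B = dim S"
    using basis_exists by metis
  \<comment> \<open>An infinite set has \<open>card\<close> 0, so the value 1 forces a singleton
    basis.\<close>
  then obtain w where w: "B = {w}"
    using S by (metis card_1_singletonE)
  moreover have "w \<noteq> 0"
    using B w dependent_zero by blast
  moreover have "S = span {w}"
    using B S w span_minimal by blast
  ultimately show "S \<in> (\<lambda>w. span {w}) ` (UNIV - {0})"
    by blast
next
  fix S :: "'h set"
  assume "S \<in> (\<lambda>w. span {w}) ` (UNIV - {0})"
  then obtain w where "w \<noteq> 0" "S = span {w}"
    by blast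
  then show "S \<in> Gr 1"
    by (simp add: Gr_def dim_eq_card_independent)
qed

text \<open>Lines and classes are both parametrized by nonzero vectors \<open>w\<close>, so both
  infima become infima over \<open>w\<close> of the same integral.\<close>

lemma normalized_width_1_squared:
  fixes p :: "'h::real_inner measure"
  assumes nz: "0 \<notin> space p" and ne: "space p \<noteq> {}"
  shows "(normalized_width 1 p)\<^sup>2 =
    (INF c\<in>(UNIV - {0}) // sine_rel. \<integral>v. (sine_dissim_class v c)\<^sup>2 \<partial>p)"
proof -
  have quotient: "(UNIV - {0}) // sine_rel = (\<lambda>w::'h. sine_rel `` {w}) ` (UNIV - {0})"
    by (auto simp: quotient_def)
  \<comment> \<open>The integrands are compared only on \<open>space p\<close>, where
    \<open>v\<close> is nonzero.\<close>
  have integral_eq: "(\<integral>v. (rel_proj_error v (span {w}))\<^sup>2 \<partial>p) =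
      (\<integral>v. (sine_dissim_class v (sine_rel `` {w}))\<^sup>2 \<partial>p)" if "w \<in> UNIV - {0}" for w
    using that nz
    by (intro Bochner_Integration.integral_cong)
      (metis Diff_iff rel_proj_error_span_singleton sine_dissim_class_eq singletonI)+
  have "(INF S\<in>Gr 1. \<integral>v. (rel_proj_error v S)\<^sup>2 \<partial>p) =
      (INF w\<in>UNIV - {0}. \<integral>v. (rel_proj_error v (span {w}))\<^sup>2 \<partial>p)"
    unfolding Gr_1_eq image_image ..
  also have "\<dots> = (INF w\<in>UNIV - {0}. \<integral>v. (sine_dissim_class v (sine_rel `` {w}))\<^sup>2 \<partial>p)"
    by (rule INF_cong[OF refl integral_eq])
  also have "\<dots> = (INF c\<in>(UNIV - {0}) // sine_rel. \<integral>v. (sine_dissim_class v c)\<^sup>2 \<partial>p)"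
    by (simp add: quotient image_image)
  finally have INF_eq: "(INF S\<in>Gr 1. \<integral>v. (rel_proj_error v S)\<^sup>2 \<partial>p) =
      (INF c\<in>(UNIV - {0}) // sine_rel. \<integral>v. (sine_dissim_class v c)\<^sup>2 \<partial>p)" .
  \<comment> \<open>Squaring undoes \<open>sqrt\<close> only for a nonnegative infimum.
    Nonnegativity of the integrals yields this once some line exists, since the infimum of an empty
    set of reals is unspecified.\<close>
  obtain w where "w \<in> space p" "w \<noteq> 0"
    using nz ne by (metis all_not_in_conv)
  then have "Gr 1 \<noteq> ({} :: 'h set set)"
    unfolding Gr_1_eq by blast
  then have "0 \<le> (INF S\<in>Gr 1. \<integral>v. (rel_proj_error v S)\<^sup>2 \<partial>p)"
    by (intro cINF_greatest) auto
  then show ?thesis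
    unfolding normalized_width_def INF_eq by (rule real_sqrt_pow2)
qed

text \<open>Passing to \<open>uniform_measure p Q\<close> keeps the underlying space, so the width
  identity applies to each conditional law and the sums agree term by term.\<close>

lemma rom_objective_1_eq_clustering_objective:
  assumes "0 \<notin> space p" "space p \<noteq> {}"
  shows "rom_objective 1 p = clustering_objective p"
  using assms unfolding rom_objective_def clustering_objective_def
  by (intro ext sum.cong refl arg_cong2[where f = times] normalized_width_1_squared) simp_all

theorem mainTheorem1:
  fixes \<Omega> :: "(real ^ 'd) set"
    and \<iota> :: "'h::{real_inner, complete_space} \<Rightarrow> real ^ 'd \<Rightarrow> real"
    and D :: "(real ^ 'p) set"
    and u :: "real ^ 'p \<Rightarrow> 'h"
    and P :: "'w measure"
    and X :: "'w \<Rightarrow> real ^ 'p"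
    and lam :: real
    and K :: nat
  assumes "open \<Omega>"
    and "L2_realization \<Omega> \<iota>"
    and "continuous_on D u"
    and "lam > 0"
    and "(INF v\<in>u ` D. norm v) > lam"
    and "prob_space P"
    and "X \<in> measurable P (restrict_space borel D)"
    and "measure_support (solution_law P X D u) = u ` D"
    and "K \<ge> 2"
  shows "{\<P>. optimal_rom_dictionary_partition K 1 (solution_law P X D u) \<P>} =
         {\<P>. optimal_clustering_partition K (solution_law P X D u) \<P>}"
proof -
  have space_law: "space (solution_law P X D u) = u ` D"
    by (simp add: solution_law_def space_restrict_space)
  \<comment> \<open>A probability space has an outcome, and \<open>X\<close> sends it into
    \<open>D\<close>.\<close>
  have "D \<noteq> {}"
    using prob_space.not_empty[OF \<open>prob_space P\<close>]
      measurable_space[OF \<open>X \<in> measurable P (restrict_space borel D)\<close>]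
    by (auto simp: space_restrict_space)
  \<comment> \<open>Otherwise the infimum of the norms would be at most 0, against the lower bound
    \<open>lam\<close>.\<close>
  moreover have "0 \<notin> u ` D"
  proof
    assume "0 \<in> u ` D"
    moreover have "bdd_below (norm ` (u ` D))"
      by (rule bdd_belowI[of _ 0]) auto
    ultimately have "(INF v\<in>u ` D. norm v) \<le> norm (0::'h)"
      by (rule cINF_lower[rotated])
    then show False
      using \<open>lam > 0\<close> \<open>(INF v\<in>u ` D. norm v) > lam\<close> by simp
  qed
  ultimately have "rom_objective 1 (solution_law P X D u) =
      clustering_objective (solution_law P X D u)"
    by (intro rom_objective_1_eq_clustering_objective) (simp_all add: space_law)
  \<comment> \<open>Equal objectives over the same admissible partitions have the same
    minimizers.\<close>
  then show ?thesis
    by (simp add: optimal_rom_dictionary_partition_def optimal_clustering_partition_def)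
qed

end
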